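(* Let $N>1$ and let $u=(v^{(k)})_{k\in\mathbb{N}}$ be a matrix generated vector sequence in $\mathbb{R}^N$. Let $\rho$ be a permutation of $C=\{1,\ldots,N\}$ which consists of $r$ disjoint cycles (fixed points counted as cycles of length one). If $\rho$ is a common proper state symmetry of all the vectors $v^{(0)},v^{(1)},\ldots,v^{(r)}$, then the vectors $v^{(0)},v^{(1)},\ldots,v^{(r)}$ are linearly dependent (as a family), and $\rho$ is a state symmetry of $v^{(k)}$ for every $k\in\mathbb{N}$.
   Context: Here $\mathbb{N}=\{0,1,2,\ldots\}$. For a permutation $\rho$ of $C=\{1,\ldots,N\}$ and a column vector $v=(v_i)\in\mathbb{R}^N$, the reordered vector is $v^\rho:=(v_{\rho(i)})_i$. The permutation $\rho$ is a state symmetry of $v$ if $v^\rho=v$; it is called proper if $\rho\neq \mathrm{id}$. A sequence $u=(v^{(k)})_{k\in\mathbb{N}}$ in $\mathbb{R}^N$ is a matrix generated vector sequence if there exists a real $N\times N$ matrix $M$ with $v^{(k+1)}=M\,v^{(k)}$ for all $k\in\mathbb{N}$. *)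

theory Defs
  imports "HOL-Analysis.Analysis" "HOL-Combinatorics.Orbits"
begin

text \<open>
  The index set \<open>{1, \<dots>, N}\<close> is rendered as a finite type \<^typ>\<open>'n\<close> with \<open>N = CARD('n)\<close>;
  the ordering of the indices plays no role below.
\<close>

definition reorder :: "('n \<Rightarrow> 'n) \<Rightarrow> real ^ 'n \<Rightarrow> real ^ 'n" where
  "reorder \<rho> v = (\<chi> i. v $ \<rho> i)"

definition state_symmetry :: "('n::finite \<Rightarrow> 'n) \<Rightarrow> real ^ 'n \<Rightarrow> bool" where
  "state_symmetry \<rho> v \<longleftrightarrow> \<rho> permutes UNIV \<and> reorder \<rho> v = v"

definition proper_state_symmetry :: "('n::finite \<Rightarrow> 'n) \<Rightarrow> real ^ 'n \<Rightarrow> bool" where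
  "proper_state_symmetry \<rho> v \<longleftrightarrow> state_symmetry \<rho> v \<and> \<rho> \<noteq> id"

definition matrix_generated :: "(nat \<Rightarrow> real ^ 'n) \<Rightarrow> bool" where
  "matrix_generated v \<longleftrightarrow> (\<exists>M :: real ^ 'n ^ 'n. \<forall>k. v (Suc k) = M *v v k)"

text \<open>
  The disjoint cycles of a permutation of a finite type correspond to its orbits;
  a fixed point \<open>x\<close> has the orbit \<open>{x}\<close> and is therefore counted as a cycle of length one.
\<close>

definition num_cycles :: "('n::finite \<Rightarrow> 'n) \<Rightarrow> nat" where
  "num_cycles \<rho> = card (range (orbit \<rho>))"

text \<open>
  The predicate \<^const>\<open>dependent\<close> speaks about sets of vectors and ignores repetitions,
  whereas a family that repeats a vector is always linearly dependent.
\<close>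

definition dependent_family :: "'i set \<Rightarrow> ('i \<Rightarrow> 'a::real_vector) \<Rightarrow> bool" where
  "dependent_family I x \<longleftrightarrow>
    (\<exists>J c. finite J \<and> J \<subseteq> I \<and> (\<exists>i\<in>J. c i \<noteq> 0) \<and> (\<Sum>i\<in>J. c i *\<^sub>R x i) = 0)"

end

theory Submission
  imports Defs
begin

text \<open>
  The vectors fixed by \<open>\<rho>\<close> are those that are constant on every cycle of \<open>\<rho>\<close>, so they form a
  subspace of dimension at most \<open>r\<close> (\<open>dim_state_symmetric_le\<close>). The \<open>r + 1\<close> vectors
  \<open>v 0, \<dots>, v r\<close> lie in it; hence some \<open>v m\<close> with \<open>m \<le> r\<close> is a linear combination of its
  predecessors (\<open>exists_in_span_predecessors\<close>), which is the asserted dependence. The same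
  relation makes the span of \<open>v 0, \<dots>, v (m - 1)\<close> invariant under the generating matrix, because
  the matrix shifts these vectors by one and the last shift \<open>v m\<close> falls back into the span. So the
  whole sequence stays in that span (\<open>iterates_in_span_predecessors\<close>), and the span consists of
  vectors fixed by \<open>\<rho>\<close>.
\<close>

lemma in_span_image_obtain_coeffs:
  fixes x :: "'i \<Rightarrow> 'a::real_vector"
  assumes "finite I" and "w \<in> span (x ` I)"
  obtains c where "w = (\<Sum>i\<in>I. c i *\<^sub>R x i)"
proof -
  from assms have "\<exists>c. w = (\<Sum>i\<in>I. c i *\<^sub>R x i)"
  proof (induction I arbitrary: w rule: finite_induct)
    case empty
    then show ?case by simp
  next
    case (insert j I)
    from insert.prems obtain k where "w - k *\<^sub>R x j \<in> span (x ` I)"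
      by (auto simp: span_breakdown_eq)
    from insert.IH[OF this] obtain c where c: "w - k *\<^sub>R x j = (\<Sum>i\<in>I. c i *\<^sub>R x i)" ..
    have "(\<Sum>i\<in>I. (c(j := k)) i *\<^sub>R x i) = (\<Sum>i\<in>I. c i *\<^sub>R x i)"
      using insert.hyps by (intro sum.cong) auto
    then have "w = (\<Sum>i\<in>insert j I. (c(j := k)) i *\<^sub>R x i)"
      using insert.hyps c by (simp add: algebra_simps)
    then show ?case by (intro exI[of _ "c(j := k)"])
  qed
  then show thesis using that by blast
qed

lemma dependent_family_if_in_span_predecessors:
  fixes x :: "nat \<Rightarrow> 'a::real_vector"
  assumes "m \<le> r" and "x m \<in> span (x ` {..<m})"
  shows "dependent_family {..r} x"
proof -
  obtain c where c: "x m = (\<Sum>i<m. c i *\<^sub>R x i)"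
    using in_span_image_obtain_coeffs[OF finite_lessThan assms(2)] .
  let ?d = "c(m := - 1)"
  have "(\<Sum>i<m. ?d i *\<^sub>R x i) = (\<Sum>i<m. c i *\<^sub>R x i)"
    by (intro sum.cong) auto
  then have "(\<Sum>i\<le>m. ?d i *\<^sub>R x i) = 0"
    using c by (simp add: lessThan_Suc_atMost[symmetric])
  moreover have "{..m} \<subseteq> {..r}" "\<exists>i\<in>{..m}. ?d i \<noteq> 0"
    using assms(1) by auto
  ultimately show ?thesis
    unfolding dependent_family_def by blast
qed

text \<open>
  Each vector outside the span of its predecessors raises the dimension by one, which can happen
  at most \<open>dim V\<close> times.
\<close>
lemma exists_in_span_predecessors:
  fixes x :: "nat \<Rightarrow> 'a::euclidean_space"
  assumes "\<And>k. k \<le> r \<Longrightarrow> x k \<in> V" and "dim V \<le> r"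
  obtains m where "m \<le> r" and "x m \<in> span (x ` {..<m})"
proof (rule ccontr)
  assume "\<not> thesis"
  with that have new: "x m \<notin> span (x ` {..<m})" if "m \<le> r" for m
    using that by blast
  have "dim (x ` {..<n}) = n" if "n \<le> Suc r" for n
    using that by (induction n) (simp_all add: lessThan_Suc dim_insert new)
  then have "dim (x ` {..<Suc r}) = Suc r" by blast
  moreover have "dim (x ` {..<Suc r}) \<le> dim V"
    by (rule dim_subset) (use assms(1) in auto)
  ultimately show False using assms(2) by simp
qed

text \<open>
  The span of \<open>x 0, \<dots>, x (m - 1)\<close> is invariant under \<open>f\<close>: its generators are mapped to
  \<open>x 1, \<dots>, x m\<close>, and the only one of these that need not be a generator is \<open>x m\<close>,
  which lies in the span by hypothesis.
\<close>
lemma iterates_in_span_predecessors: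
  fixes x :: "nat \<Rightarrow> 'a::real_vector"
  assumes "linear f" and step: "\<And>k. x (Suc k) = f (x k)"
    and m: "x m \<in> span (x ` {..<m})"
  shows "x k \<in> span (x ` {..<m})"
proof (induction k)
  case 0
  \<comment> \<open>If \<open>m = 0\<close>, then \<open>x 0\<close> is no generator, but the hypothesis is the claim itself.\<close>
  show ?case
    using m by (cases "m = 0") (auto intro: span_base)
next
  case (Suc k)
  have "x (Suc i) \<in> span (x ` {..<m})" if "i < m" for i
    using that m by (cases "Suc i = m") (auto intro: span_base)
  then have "f ` x ` {..<m} \<subseteq> span (x ` {..<m})"
    by (auto simp: step[symmetric])
  then have "span (f ` x ` {..<m}) \<subseteq> span (x ` {..<m})"
    by (rule span_minimal) (rule subspace_span)
  then have "f ` span (x ` {..<m}) \<subseteq> span (x ` {..<m})"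
    by (simp add: linear_span_image[OF assms(1)])
  then show ?case using Suc step by auto
qed

lemma subspace_reorder_fixed: "subspace {x. reorder \<rho> x = x}"
  by (auto simp: subspace_def reorder_def vec_eq_iff)

text \<open>
  A fixed vector is constant on every orbit, hence it is a combination of the indicator vectors of
  the orbits, and there are \<open>num_cycles \<rho>\<close> of these.
\<close>
lemma dim_state_symmetric_le:
  fixes \<rho> :: "'n::finite \<Rightarrow> 'n"
  assumes \<rho>: "\<rho> permutes UNIV"
  shows "dim {x :: real ^ 'n. reorder \<rho> x = x} \<le> num_cycles \<rho>"
proof -
  define ind :: "'n set \<Rightarrow> real ^ 'n" where "ind A = (\<chi> i. indicator A i)" for A
  have perm: "permutation \<rho>"
    using \<rho> by (auto simp: permutation_permutes)
  have orbit_iff: "i \<in> orbit \<rho> j \<longleftrightarrow> orbit \<rho> j = orbit \<rho> i" for i j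
  proof
    show "i \<in> orbit \<rho> j" if "orbit \<rho> j = orbit \<rho> i"
      using that permutation_self_in_orbit[OF perm] by simp
    show "orbit \<rho> j = orbit \<rho> i" if "i \<in> orbit \<rho> j"
      using orbit_cyclic_eq3[OF cyclic_on_orbit'[OF perm] that] by simp
  qed
  have "x \<in> span (ind ` range (orbit \<rho>))" if x: "reorder \<rho> x = x" for x :: "real ^ 'n"
  proof -
    have inv: "x $ \<rho> i = x $ i" for i
      using x by (auto simp: reorder_def vec_eq_iff)
    have const: "x $ i = x $ j" if "i \<in> orbit \<rho> j" for i j
      using that by induction (simp_all add: inv)
    define rep where "rep A = (SOME i. orbit \<rho> i = A)" for A
    have rep: "orbit \<rho> (rep (orbit \<rho> i)) = orbit \<rho> i" for i
      unfolding rep_def by (rule someI) (rule refl)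
    have "x $ i = (\<Sum>A\<in>range (orbit \<rho>). x $ rep A *\<^sub>R ind A) $ i" for i
    proof -
      have "(\<Sum>A\<in>range (orbit \<rho>). x $ rep A *\<^sub>R ind A) $ i
          = (\<Sum>A\<in>range (orbit \<rho>). if A = orbit \<rho> i then x $ rep A else 0)"
        unfolding sum_component
      proof (rule sum.cong)
        show "(x $ rep A *\<^sub>R ind A) $ i = (if A = orbit \<rho> i then x $ rep A else 0)"
          if A: "A \<in> range (orbit \<rho>)" for A
        proof -
          from A obtain j where "A = orbit \<rho> j" ..
          then have "i \<in> A \<longleftrightarrow> A = orbit \<rho> i"
            by (simp only: orbit_iff)
          then show ?thesis
            by (simp add: ind_def indicator_def)
        qed
      qed (rule refl)
      also have "\<dots> = x $ rep (orbit \<rho> i)"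
        by simp
      also have "\<dots> = x $ i"
        by (rule const[OF orbit_iff[THEN iffD2, OF rep[symmetric]]])
      finally show ?thesis ..
    qed
    then have "x = (\<Sum>A\<in>range (orbit \<rho>). x $ rep A *\<^sub>R ind A)"
      unfolding vec_eq_iff by (rule allI)
    also have "\<dots> \<in> span (ind ` range (orbit \<rho>))"
      by (intro span_sum span_scale span_base) auto
    finally show ?thesis .
  qed
  then have "dim {x :: real ^ 'n. reorder \<rho> x = x} \<le> card (ind ` range (orbit \<rho>))"
    by (intro dim_le_card) auto
  also have "\<dots> \<le> num_cycles \<rho>"
    unfolding num_cycles_def by (rule card_image_le) simp
  finally show ?thesis .
qed

theorem theorem5:
  fixes v :: "nat \<Rightarrow> real ^ 'n"
    and \<rho> :: "'n \<Rightarrow> 'n"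
    and r :: nat
  assumes "CARD('n) > 1"
    and "matrix_generated v"
    and "\<rho> permutes UNIV"
    and "num_cycles \<rho> = r"
    and "\<forall>k\<le>r. proper_state_symmetry \<rho> (v k)"
  shows "dependent_family {..r} v \<and> (\<forall>k. state_symmetry \<rho> (v k))"
proof -
  let ?F = "{x :: real ^ 'n. reorder \<rho> x = x}"
  have fixed: "v k \<in> ?F" if "k \<le> r" for k
    using assms(5) that by (simp add: proper_state_symmetry_def state_symmetry_def)
  moreover have "dim ?F \<le> r"
    using dim_state_symmetric_le[OF assms(3)] assms(4) by simp
  ultimately obtain m where m: "m \<le> r" "v m \<in> span (v ` {..<m})"
    by (rule exists_in_span_predecessors)
  obtain M :: "real ^ 'n ^ 'n" where M: "\<And>k. v (Suc k) = M *v v k"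
    using assms(2) unfolding matrix_generated_def by blast
  have "v ` {..<m} \<subseteq> ?F"
    using fixed m(1) by auto
  then have "span (v ` {..<m}) \<subseteq> ?F"
    by (rule span_minimal) (rule subspace_reorder_fixed)
  then have "v k \<in> ?F" for k
    using iterates_in_span_predecessors[OF matrix_vector_mul_linear M m(2)] by blast
  then have "state_symmetry \<rho> (v k)" for k
    using assms(3) by (simp add: state_symmetry_def)
  then show ?thesis
    using dependent_family_if_in_span_predecessors[OF m] by blast
qed

end
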